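(* Let $C_1, C_2, C_3, C_4, C_5, C_6$ be real numbers from $(0,1)$ satisfying the following inequalities: \begin{align*} C_1 < C_3 &< C_5 \\ C_2 + C_4 &\geq 1 \\ C_1+C_2+C_3 &\leq 1 \\ \frac{C_2}{C_1}> \frac{C_4-C_2}{C_3-C_1} > \frac{C_6-C_4}{C_5-C_3} = 1 &> \frac{1-C_6}{1-C_5} \end{align*} Let $e(\alpha)$ be the piecewise linear function connecting the points $$[0,0], \qquad [C_1, C_2], \qquad [C_3,C_4], \qquad [C_5,C_6], \qquad [1,1].$$ Suppose that for every $N$ the graph $E_N$ is a bipartite graph with $N$ left vertices $\{x_1, \dots, x_N\}$ and $N$ right vertices $\{y_1, \dots, y_N\}$ and edges directed from left to right with the following properties: \begin{enumerate}[(a)] \item $E_N$ is an $(N, \alpha, e(\alpha))$-expander for every $\alpha\in[0,1]$. \item $E_N$ is an $(N,\alpha ,1)$-pair-expander for every $\alpha \in [0,C_3]$ where the pairs are $(y_i, y_{i+N/2})$ for $i \in \{1,\dots, N/2\}$. \end{enumerate} Then $\Gamma_N$ is an $N$-superconcentrator.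
   Context: An $N$-superconcentrator is a directed acyclic graph with exactly $N$ input nodes $I$ and $N$ output nodes $O$ such that for every $S\subset I$, $T\subset O$ with $|S|=|T|=k$ there exist $k$ node-disjoint paths connecting $S$ to $T$. A bipartite graph with $N$ left vertices $L$, $N$ right vertices $R$ and edges directed from $L$ to $R$ is an $(N,\alpha,\beta)$-expander ($\alpha,\beta\in[0,1]$) if every $S\subset L$ with $|S|=\lfloor\alpha N\rfloor$ has $|\Gamma(S)|\ge\lceil\beta N\rceil$, where $\Gamma(S)\subset R$ is the set of neighbours of $S$. Assume $N$ is even and the right vertices $R$ are grouped into pairs. A left vertex is adjacent to a pair if it is adjacent to at least one vertex of the pair; a set $U\subset L$ is adjacent to a pair if some vertex of $U$ is. Such a graph is an $(N,\alpha,\gamma)$-pair-expander if every $U\subset L$ with $|U|=k=\lfloor\alpha N\rfloor$ is adjacent to at least $\lfloor\gamma k\rfloor$ pairs. The graph $\Gamma_N$ (for sufficiently large $N$) is defined recursively: let $X$, $Y$ be disjoint sets of $N$ vertices (inputs and outputs of $\Gamma_N$), and $X'=\{x'_1,\dots,x'_N\}$, $Y'=\{y'_1,\dots,y'_N\}$ further disjoint sets. A copy of $E_N$ is placed between $X$ and $X'$ with edges directed from $X$ to $X'$ (edge set $\Lambda_X$), and a copy of the reverse of $E_N$ is placed between $Y'$ and $Y$ with edges directed from $Y'$ to $Y$ (edge set $\Lambda_Y$). For each $i\in\{1,\dots,N/2\}$, the edges $(x'_{i+N/2},y'_i)$, $(x'_{i+N/2},x'_i)$, $(x'_i,y'_{i+N/2})$,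 $(y'_i,y'_{i+N/2})$ are in $\Gamma_N$. Finally, with $X''=\{x'_i : i\le N/2\}$ and $Y''=\{y'_i : i\le N/2\}$, the edges of the superconcentrator $\Gamma_{N/2}$ are placed between $X''$ (inputs) and $Y''$ (outputs), where $\Gamma_{N/2}$ is built in the same way from $E_{N/2}$.
   Formalization: The expander condition is required only for nonempty S (for 0<αN<1 the empty set would violate it), and the unspecified start of the recursion is taken, below an arbitrary threshold, to be any superconcentrator whose inputs are sources and outputs are sinks. *)

theory Defs
  imports Complex_Main "HOL-Library.Disjoint_Sets"
    "Graph_Theory.Pair_Digraph" "Graph_Theory.Vertex_Walk"
begin

definition superconcentrator ::
    "nat \<Rightarrow> 'v pair_pre_digraph \<Rightarrow> 'v set \<Rightarrow> 'v set \<Rightarrow> bool" where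
  "superconcentrator N G I J \<longleftrightarrow>
     pair_fin_digraph G \<and> acyclic (parcs G) \<and>
     I \<subseteq> pverts G \<and> J \<subseteq> pverts G \<and> I \<inter> J = {} \<and> card I = N \<and> card J = N \<and>
     (\<forall>S T. S \<subseteq> I \<and> T \<subseteq> J \<and> card S = card T \<longrightarrow>
        (\<exists>P. finite P \<and> card P = card S \<and> disjoint_family_on set P \<and>
             (\<forall>p\<in>P. vpath p (with_proj G) \<and> hd p \<in> S \<and> last p \<in> T)))"

text \<open>
  A bipartite graph with left vertices \<open>x\<^sub>1, \<dots>, x\<^sub>N\<close> and right vertices
  \<open>y\<^sub>1, \<dots>, y\<^sub>N\<close> is given by the set of index pairs \<open>(i, j)\<close> of its edges
  \<open>(x\<^sub>i, y\<^sub>j)\<close>, so the set of neighbours of a left set \<open>S\<close> is \<open>E `` S\<close>.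
\<close>

definition bipartite_edges :: "nat \<Rightarrow> (nat \<times> nat) set \<Rightarrow> bool" where
  "bipartite_edges N E \<longleftrightarrow> E \<subseteq> {1..N} \<times> {1..N}"

text \<open>
  The empty set is excluded: for \<open>0 < \<alpha> N < 1\<close> it is the only set of size
  \<open>\<lfloor>\<alpha> N\<rfloor>\<close>, and it has no \<open>\<lceil>\<beta> N\<rceil>\<close> neighbours unless \<open>\<beta> = 0\<close>.
\<close>

definition expander :: "nat \<Rightarrow> real \<Rightarrow> real \<Rightarrow> (nat \<times> nat) set \<Rightarrow> bool" where
  "expander N \<alpha> \<beta> E \<longleftrightarrow>
     (\<forall>S \<subseteq> {1..N}. S \<noteq> {} \<and> int (card S) = \<lfloor>\<alpha> * real N\<rfloor> \<longrightarrow>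
        \<lceil>\<beta> * real N\<rceil> \<le> int (card (E `` S)))"

definition half_pairs :: "nat \<Rightarrow> nat set set" where
  "half_pairs N = (\<lambda>i. {i, i + N div 2}) ` {1..N div 2}"

definition pair_expander ::
    "nat \<Rightarrow> real \<Rightarrow> real \<Rightarrow> nat set set \<Rightarrow> (nat \<times> nat) set \<Rightarrow> bool" where
  "pair_expander N \<alpha> \<gamma> Q E \<longleftrightarrow>
     (\<forall>U \<subseteq> {1..N}. int (card U) = \<lfloor>\<alpha> * real N\<rfloor> \<longrightarrow>
        \<lfloor>\<gamma> * real (card U)\<rfloor> \<le> int (card {q \<in> Q. E `` U \<inter> q \<noteq> {}}))"

definition pw_linear ::
    "real \<Rightarrow> real \<Rightarrow> real \<Rightarrow> real \<Rightarrow> real \<Rightarrow> real \<Rightarrow> real \<Rightarrow> real" where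
  "pw_linear C1 C2 C3 C4 C5 C6 \<alpha> =
     (if \<alpha> \<le> C1 then C2 / C1 * \<alpha>
      else if \<alpha> \<le> C3 then C2 + (C4 - C2) / (C3 - C1) * (\<alpha> - C1)
      else if \<alpha> \<le> C5 then C4 + (C6 - C4) / (C5 - C3) * (\<alpha> - C3)
      else C6 + (1 - C6) / (1 - C5) * (\<alpha> - C5))"

text \<open>
  \<open>Gamma E N\<^sub>0 N G x y\<close>: the digraph \<open>G\<close> is a copy of \<open>\<Gamma>\<^sub>N\<close> with inputs
  \<open>x 1, \<dots>, x N\<close> and outputs \<open>y 1, \<dots>, y N\<close>. The recursive construction is used
  from the threshold \<open>N\<^sub>0\<close> on; below it, any superconcentrator may be taken whose inputs are
  sources and whose outputs are sinks. In the recursive rule, \<open>x' i\<close> and \<open>y' i\<close>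
  with \<open>i \<le> N div 2\<close> are the inputs and outputs of the copy \<open>H\<close> of
  \<open>\<Gamma>\<close> of size \<open>N div 2\<close>; all other vertices listed are new.
\<close>

inductive Gamma ::
    "(nat \<Rightarrow> (nat \<times> nat) set) \<Rightarrow> nat \<Rightarrow> nat \<Rightarrow> 'v pair_pre_digraph \<Rightarrow>
     (nat \<Rightarrow> 'v) \<Rightarrow> (nat \<Rightarrow> 'v) \<Rightarrow> bool"
  for E :: "nat \<Rightarrow> (nat \<times> nat) set" and N\<^sub>0 :: nat
where
  base: "Gamma E N\<^sub>0 N G x y"
    if "N < N\<^sub>0"
      and "superconcentrator N G (x ` {1..N}) (y ` {1..N})"
      and "\<And>u v. (u, v) \<in> parcs G \<Longrightarrow> v \<notin> x ` {1..N} \<and> u \<notin> y ` {1..N}"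
| step: "Gamma E N\<^sub>0 N
      \<lparr>pverts = pverts H \<union> x ` {1..N} \<union> y ` {1..N} \<union> x' ` {1..N} \<union> y' ` {1..N},
       parcs = parcs H
         \<union> {(x i, x' j) | i j. (i, j) \<in> E N}
         \<union> {(y' j, y i) | i j. (i, j) \<in> E N}
         \<union> (\<Union>i\<in>{1..N div 2}.
              {(x' (i + N div 2), y' i), (x' (i + N div 2), x' i),
               (x' i, y' (i + N div 2)), (y' i, y' (i + N div 2))})\<rparr> x y"
    if "N\<^sub>0 \<le> N" and "even N"
      and "Gamma E N\<^sub>0 (N div 2) H x' y'"
      and "distinct (map x [1..<Suc N] @ map y [1..<Suc N] @
                     map x' [1..<Suc N] @ map y' [1..<Suc N])"
      and "(x ` {1..N} \<union> y ` {1..N} \<union> x' ` {N div 2<..N} \<union> y' ` {N div 2<..N})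
             \<inter> pverts H = {}"

end

theory Submission
  imports Defs
begin

text \<open>
  Replace the inner copy of \<open>\<Gamma>\<^bsub>N/2\<^esub>\<close> by the complete bipartite graph between its inputs and
  outputs; paths through it can afterwards be rerouted through the real one. In the resulting
  graph, \<open>k\<close> disjoint paths from \<open>S\<close> to \<open>T\<close> amount to an injection that moves every
  vertex outside \<open>T\<close> along an arc or fixes it, and that avoids \<open>S\<close>; so they are provided by Hall's
  theorem. Counting pair by pair, Hall's condition becomes
  \<open>|U| + |V| \<le> k + \<Sum>\<^sub>i min(g\<^sub>i, h\<^sub>i + 1)\<close> for \<open>U \<subseteq> S\<close>, \<open>V \<subseteq> T\<close>, where \<open>g\<^sub>i\<close> and \<open>h\<^sub>i\<close> are the
  numbers of neighbours of \<open>U\<close> and \<open>V\<close> in the \<open>i\<close>-th pair, together with the same inequality with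
  \<open>g\<close> and \<open>h\<close> exchanged. If \<open>|U|\<close> or \<open>|V|\<close> is at most \<open>C\<^sub>3 N\<close>, this is pair expansion. Otherwise it
  follows from \<open>3 e(t) \<ge> 1 + 2 t\<close> on \<open>[C\<^sub>3, 1]\<close>, where \<open>e\<close> is linear on \<open>[C\<^sub>3, C\<^sub>5]\<close> and
  \<open>[C\<^sub>5, 1]\<close>; at \<open>t = C\<^sub>3\<close> it is the sum of \<open>C\<^sub>4 \<ge> 1 - C\<^sub>2\<close>, \<open>C\<^sub>4 \<ge> C\<^sub>2 + C\<^sub>3 - C\<^sub>1\<close> and
  \<open>C\<^sub>4 \<ge> 1 - C\<^sub>2 \<ge> C\<^sub>1 + C\<^sub>3\<close>.
\<close>

subsection \<open>Hall's theorem\<close>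

definition marriage_condition :: "('i \<Rightarrow> 'a set) \<Rightarrow> 'i set \<Rightarrow> bool" where
  "marriage_condition F I \<longleftrightarrow> (\<forall>J\<subseteq>I. card J \<le> card (\<Union>(F ` J)))"

lemma marriage_condition_subset: "marriage_condition F I \<Longrightarrow> J \<subseteq> I \<Longrightarrow> marriage_condition F J"
  unfolding marriage_condition_def by blast

lemma marriage_condition_Diff_tight:
  assumes "finite I" "marriage_condition F I" "J \<subseteq> I" and tight: "card (\<Union>(F ` J)) = card J"
  shows "marriage_condition (\<lambda>i. F i - \<Union>(F ` J)) (I - J)"
  unfolding marriage_condition_def
proof (intro allI impI)
  let ?F = "\<lambda>i. F i - \<Union>(F ` J)"
  fix K assume K: "K \<subseteq> I - J"
  have "card K + card J = card (K \<union> J)"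
    using K assms(1,3) finite_subset by (intro card_Un_disjoint[symmetric]) blast+
  also have "\<dots> \<le> card (\<Union>(F ` (K \<union> J)))"
    using K assms(2,3) unfolding marriage_condition_def by blast
  also have "\<Union>(F ` (K \<union> J)) = \<Union>(?F ` K) \<union> \<Union>(F ` J)" by auto
  also have "card \<dots> \<le> card (\<Union>(?F ` K)) + card J" using card_Un_le tight by metis
  finally show "card K \<le> card (\<Union>(?F ` K))" by simp
qed

lemma marriage_condition_Diff_loose:
  assumes loose: "\<And>J. J \<noteq> {} \<Longrightarrow> J \<subset> I \<Longrightarrow> card J < card (\<Union>(F ` J))" and "i \<in> I"
  shows "marriage_condition (\<lambda>j. F j - {a}) (I - {i})"
  unfolding marriage_condition_def
proof (intro allI impI)
  fix K assume K: "K \<subseteq> I - {i}"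
  show "card K \<le> card (\<Union>j\<in>K. F j - {a})"
  proof (cases "K = {}")
    case False
    then have "card K < card (\<Union>(F ` K))" using loose K \<open>i \<in> I\<close> by blast
    moreover have "(\<Union>j\<in>K. F j - {a}) = \<Union>(F ` K) - {a}" by auto
    ultimately show ?thesis by (auto simp: card_Diff_singleton_if)
  qed simp
qed

lemma ex_representatives_Un:
  assumes R\<^sub>1: "inj_on R\<^sub>1 J" "\<forall>i\<in>J. R\<^sub>1 i \<in> F i" and "J \<subseteq> I"
    and R\<^sub>2: "inj_on R\<^sub>2 (I - J)" "\<forall>i\<in>I - J. R\<^sub>2 i \<in> F i - \<Union>(F ` J)"
  shows "\<exists>R. inj_on R I \<and> (\<forall>i\<in>I. R i \<in> F i)"
proof -
  let ?R = "\<lambda>i. if i \<in> J then R\<^sub>1 i else R\<^sub>2 i"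
  have "inj_on ?R (J \<union> (I - J))"
  proof (rule inj_on_disjoint_Un[OF R\<^sub>1(1) R\<^sub>2(1)])
    show "R\<^sub>1 ` J \<inter> R\<^sub>2 ` (I - J) = {}" using R\<^sub>1(2) R\<^sub>2(2) by fastforce
  qed
  then show ?thesis
    using R\<^sub>1(2) R\<^sub>2(2) \<open>J \<subseteq> I\<close> by (intro exI[of _ ?R]) (auto simp: Un_absorb1)
qed

theorem hall_marriage:
  assumes "finite I" "marriage_condition F I"
  shows "\<exists>R. inj_on R I \<and> (\<forall>i\<in>I. R i \<in> F i)"
  using assms
proof (induction I arbitrary: F rule: finite_psubset_induct)
  case (psubset I)
  consider "I = {}"
    | (tight) J where "J \<noteq> {}" "J \<subset> I" "card (\<Union>(F ` J)) = card J"
    | (loose) i where "i \<in> I" "\<And>J. J \<noteq> {} \<Longrightarrow> J \<subset> I \<Longrightarrow> card J < card (\<Union>(F ` J))"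
  proof -
    have "card J < card (\<Union>(F ` J))" if "J \<subset> I" "card (\<Union>(F ` J)) \<noteq> card J" for J
      using psubset.prems that unfolding marriage_condition_def
      by (simp add: le_neq_implies_less psubset_imp_subset)
    then show ?thesis using that by (metis ex_in_conv)
  qed
  then show ?case
  proof cases
    case tight
    then have subs: "J \<subseteq> I" "I - J \<subset> I" by auto
    obtain R\<^sub>1 where R\<^sub>1: "inj_on R\<^sub>1 J" "\<forall>i\<in>J. R\<^sub>1 i \<in> F i"
      using psubset.IH[OF tight(2) marriage_condition_subset[OF psubset.prems subs(1)]] by blast
    have "marriage_condition (\<lambda>i. F i - \<Union>(F ` J)) (I - J)"
      using psubset.hyps psubset.prems subs(1) tight(3) by (rule marriage_condition_Diff_tight)
    then obtain R\<^sub>2 where R\<^sub>2: "inj_on R\<^sub>2 (I - J)" "\<forall>i\<in>I - J. R\<^sub>2 i \<in> F i - \<Union>(F ` J)"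
      using psubset.IH[OF subs(2)] by meson
    show ?thesis using R\<^sub>1 subs(1) R\<^sub>2 by (rule ex_representatives_Un)
  next
    case loose
    have "card {i} \<le> card (\<Union>(F ` {i}))"
      using loose(1) by (intro psubset.prems[unfolded marriage_condition_def, rule_format]) simp
    then have "F i \<noteq> {}" by auto
    then obtain a where a: "a \<in> F i" by blast
    have "I - {i} \<subset> I" using loose(1) by blast
    then obtain R where R: "inj_on R (I - {i})" "\<forall>j\<in>I - {i}. R j \<in> F j - {a}"
      using psubset.IH[OF _ marriage_condition_Diff_loose[OF loose(2,1), of a]] by meson
    have "inj_on (R(i := a)) I" using R by (auto simp: inj_on_def)
    moreover have "\<forall>j\<in>I. (R(i := a)) j \<in> F j" using R(2) a by simp
    ultimately show ?thesis by blast
  qed simp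
qed

subsection \<open>Linkings\<close>

text \<open>
  \<open>R\<close> is the set of arcs of vertex-disjoint paths that lead from \<open>S\<close> onto \<open>T\<close>,
  possibly together with some cycles.
\<close>

definition linking :: "('v \<times> 'v) set \<Rightarrow> 'v set \<Rightarrow> 'v set \<Rightarrow> ('v \<times> 'v) set \<Rightarrow> bool" where
  "linking A S T R \<longleftrightarrow> R \<subseteq> A \<and> inj_on fst R \<and> inj_on snd R \<and>
     S \<inter> Range R = {} \<and> T \<inter> Domain R = {} \<and> S \<union> Range R = T \<union> Domain R"

lemma card_Domain_eq_card_Range:
  assumes "inj_on fst R" "inj_on snd R"
  shows "card (Domain R) = card (Range R)"
  using assms by (simp add: Domain_fst Range_snd card_image)

lemma linking_Diff_first_arc:
  assumes "linking A S T R" "s \<in> S" "(s, t) \<in> R"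
  shows "linking A (insert t (S - {s})) T (R - {(s, t)})"
proof -
  have inj: "inj_on fst R" "inj_on snd R" and flow: "S \<union> Range R = T \<union> Domain R"
    and ST: "S \<inter> Range R = {}" "T \<inter> Domain R = {}" and "R \<subseteq> A"
    using assms(1) unfolding linking_def by blast+
  have dom: "Domain (R - {(s, t)}) = Domain R - {s}"
    using inj_onD[OF inj(1) _ _ assms(3)] assms(3) by auto
  have ran: "Range (R - {(s, t)}) = Range R - {t}"
    using inj_onD[OF inj(2) _ _ assms(3)] assms(3) by auto
  show ?thesis
    unfolding linking_def dom ran
  proof (intro conjI)
    show "inj_on fst (R - {(s, t)})" "inj_on snd (R - {(s, t)})" using inj inj_on_subset by blast+
  qed (use flow ST \<open>R \<subseteq> A\<close> assms(2,3) in blast)+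
qed

definition path_system :: "'v pair_pre_digraph \<Rightarrow> 'v set \<Rightarrow> 'v set \<Rightarrow> 'v set \<Rightarrow> ('v \<Rightarrow> 'v list) \<Rightarrow> bool"
  where "path_system G W S T \<pi> \<longleftrightarrow> disjoint_family_on (\<lambda>s. set (\<pi> s)) S \<and>
    (\<forall>s\<in>S. vpath (\<pi> s) (with_proj G) \<and> hd (\<pi> s) = s \<and> last (\<pi> s) \<in> T \<and> set (\<pi> s) \<subseteq> W)"

lemma path_system_trivial:
  assumes "S \<subseteq> pverts G" "S \<subseteq> T" "S \<subseteq> W"
  shows "path_system G W S T (\<lambda>s. [s])"
proof -
  have "vpath [s] (with_proj G)" if "s \<in> S" for s
    using that assms(1) by (intro vpathI vwalkI) auto
  then show ?thesis
    using assms(2,3) unfolding path_system_def by (auto simp: disjoint_family_on_def)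
qed

lemma path_system_prepend:
  assumes sys: "path_system G W (insert t (S - {s})) T \<pi>"
    and s: "s \<in> S" "s \<in> pverts G" "s \<notin> W" and t: "t \<notin> S" "(s, t) \<in> parcs G"
  shows "path_system G (insert s W) S T (\<pi>(s := s # \<pi> t))"
proof -
  have disj: "disjoint_family_on (\<lambda>v. set (\<pi> v)) (insert t (S - {s}))"
    and paths: "\<forall>v\<in>insert t (S - {s}). vpath (\<pi> v) (with_proj G) \<and> hd (\<pi> v) = v \<and>
      last (\<pi> v) \<in> T \<and> set (\<pi> v) \<subseteq> W"
    using sys unfolding path_system_def by simp_all
  note \<pi> = bspec[OF paths]
  have new: "s \<notin> set (\<pi> v)" if "v \<in> insert t (S - {s})" for v
    using \<pi>[OF that] s(3) by blast
  have "\<pi> t \<noteq> []" using \<pi>[of t] by auto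
  have "vpath (s # \<pi> t) (with_proj G)"
  proof
    show "vwalk (s # \<pi> t) (with_proj G)" using \<pi>[of t] s(2) t(2) by (intro vwalk_consI) auto
    show "distinct (s # \<pi> t)" using \<pi>[of t] new[of t] by auto
  qed
  moreover have "disjoint_family_on (\<lambda>v. set ((\<pi>(s := s # \<pi> t)) v)) S"
    unfolding disjoint_family_on_def
  proof (intro ballI impI)
    fix u v assume uv: "u \<in> S" "v \<in> S" "u \<noteq> v"
    then have "u \<noteq> t" "v \<noteq> t" using t(1) by blast+
    with uv show "set ((\<pi>(s := s # \<pi> t)) u) \<inter> set ((\<pi>(s := s # \<pi> t)) v) = {}"
      using disjoint_family_onD[OF disj, of "if u = s then t else u" "if v = s then t else v"]
        new[of u] new[of v] by (auto split: if_splits)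
  qed
  ultimately show ?thesis
    unfolding path_system_def using \<pi> \<open>\<pi> t \<noteq> []\<close> by auto
qed

lemma path_system_mono: "path_system G W S T \<pi> \<Longrightarrow> W \<subseteq> W' \<Longrightarrow> path_system G W' S T \<pi>"
  unfolding path_system_def by blast

lemma path_system_if_linking:
  assumes "pair_wf_digraph G" "finite R" "linking (parcs G) S T R" "S \<subseteq> pverts G"
  shows "\<exists>\<pi>. path_system G (S \<union> Range R) S T \<pi>"
  using assms(2-4)
proof (induction R arbitrary: S rule: finite_psubset_induct)
  case (psubset R)
  interpret pair_wf_digraph G by fact
  have RA: "R \<subseteq> parcs G" and S: "S \<inter> Range R = {}" "S \<union> Range R = T \<union> Domain R"
    using psubset.prems(1) unfolding linking_def by simp_all
  show ?case
  proof (cases "S \<inter> Domain R = {}")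
    case True
    then have "S \<subseteq> T" using S(2) by blast
    then show ?thesis using path_system_trivial psubset.prems(2) by blast
  next
    case False
    then obtain s t where st: "s \<in> S" "(s, t) \<in> R" by blast
    let ?S = "insert t (S - {s})" and ?R = "R - {(s, t)}"
    have arc: "(s, t) \<in> parcs G" "s \<in> pverts G" "t \<in> pverts G" "t \<notin> S"
      using st RA S(1) psubset.prems(2) in_arcsD2 by blast+
    have smaller: "?R \<subset> R" "?S \<subseteq> pverts G" using st(2) arc(3) psubset.prems(2) by blast+
    obtain \<pi> where \<pi>: "path_system G (?S \<union> Range ?R) ?S T \<pi>"
      using psubset.IH[OF smaller(1) linking_Diff_first_arc[OF psubset.prems(1) st] smaller(2)]
      by (rule exE)
    have "s \<notin> ?S \<union> Range ?R" using st S(1) by blast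
    moreover have "insert s (?S \<union> Range ?R) \<subseteq> S \<union> Range R" using st by blast
    ultimately show ?thesis
      using path_system_mono[OF path_system_prepend[OF \<pi> st(1) arc(2) _ arc(4,1)]] by meson
  qed
qed

lemma vwalk_arcs_eq_zip: "vwalk_arcs p = zip (butlast p) (tl p)"
  by (induction p rule: vwalk_arcs.induct) auto

lemma Domain_vwalk_arcs: "Domain (set (vwalk_arcs p)) = set (butlast p)"
  unfolding vwalk_arcs_eq_zip Domain_fst by (simp flip: set_map)

lemma Range_vwalk_arcs: "Range (set (vwalk_arcs p)) = set (tl p)"
  unfolding vwalk_arcs_eq_zip Range_snd by (simp flip: set_map)

lemma inj_on_vwalk_arcs:
  assumes "distinct p"
  shows "inj_on fst (set (vwalk_arcs p))" "inj_on snd (set (vwalk_arcs p))"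
proof -
  have "distinct (map fst (vwalk_arcs p))" "distinct (map snd (vwalk_arcs p))"
    unfolding vwalk_arcs_eq_zip using assms by (simp_all add: distinct_butlast distinct_tl)
  then show "inj_on fst (set (vwalk_arcs p))" "inj_on snd (set (vwalk_arcs p))"
    by (simp_all add: distinct_map)
qed

lemma inj_on_UNION_disjoint:
  assumes "\<And>i. i \<in> I \<Longrightarrow> inj_on f (A i)" "disjoint_family_on (\<lambda>i. f ` A i) I"
  shows "inj_on f (\<Union>i\<in>I. A i)"
proof (rule inj_onI)
  fix a b assume "a \<in> (\<Union>i\<in>I. A i)" "b \<in> (\<Union>i\<in>I. A i)" and eq: "f a = f b"
  then obtain i j where ij: "i \<in> I" "a \<in> A i" "j \<in> I" "b \<in> A j" by blast
  then have "i = j" using disjoint_family_onD[OF assms(2), of i j] eq by blast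
  then show "a = b" using inj_onD[OF assms(1) eq] ij by blast
qed

lemma distinct_set_ends:
  assumes "p \<noteq> []" "distinct p"
  shows "set p = insert (hd p) (set (tl p))" "hd p \<notin> set (tl p)"
    and "set p = insert (last p) (set (butlast p))" "last p \<notin> set (butlast p)"
proof -
  show "set p = insert (hd p) (set (tl p))" "hd p \<notin> set (tl p)"
    using assms by (cases p; simp)+
  show "set p = insert (last p) (set (butlast p))" "last p \<notin> set (butlast p)"
    using assms by (cases p rule: rev_cases; simp)+
qed

lemma linking_if_paths:
  assumes P: "card P = card S" "card P = card T" "finite S" "finite T" "disjoint_family_on set P"
    and path: "\<forall>p\<in>P. vpath p (with_proj G) \<and> hd p \<in> S \<and> last p \<in> T"
  shows "linking (parcs G) S T (\<Union>p\<in>P. set (vwalk_arcs p))" (is "linking _ _ _ ?R")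
proof -
  have ne: "p \<noteq> []" and dist: "distinct p" and arcs: "set (vwalk_arcs p) \<subseteq> parcs G"
    if "p \<in> P" for p
    using bspec[OF path that] by (auto simp: vpath_def vwalk_def)
  note ends = distinct_set_ends[OF ne dist]
  have eq: "p = q" if "p \<in> P" "q \<in> P" "v \<in> set p" "v \<in> set q" for p q v
    using disjoint_family_onD[OF P(5) that(1,2)] that(3,4) by blast
  have "inj_on hd P" "inj_on last P"
    using eq ne by (auto intro!: inj_onI) (metis hd_in_set last_in_set)+
  then have S: "S = hd ` P" and T: "T = last ` P"
    using P(1-4) path card_subset_eq[of S "hd ` P"] card_subset_eq[of T "last ` P"]
    by (simp_all add: card_image image_subset_iff)
  have D: "Domain ?R = (\<Union>p\<in>P. set (butlast p))" and R: "Range ?R = (\<Union>p\<in>P. set (tl p))"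
    by (simp_all add: Domain_Union Range_Union image_image Domain_vwalk_arcs Range_vwalk_arcs)
  show ?thesis
    unfolding linking_def
  proof (intro conjI)
    show "?R \<subseteq> parcs G" using arcs by blast
    have "disjoint_family_on (\<lambda>p. set (butlast p)) P" "disjoint_family_on (\<lambda>p. set (tl p)) P"
      using P(5) ends unfolding disjoint_family_on_def by blast+
    then show "inj_on fst ?R" "inj_on snd ?R"
      using inj_on_vwalk_arcs[OF dist]
      by (auto intro!: inj_on_UNION_disjoint simp: Domain_vwalk_arcs Range_vwalk_arcs
          simp flip: Domain_fst Range_snd)
    have "hd p \<notin> set (tl q)" "last p \<notin> set (butlast q)" if "p \<in> P" "q \<in> P" for p q
      using eq[OF that, of "hd p"] eq[OF that, of "last p"] ends that by blast+
    then show "S \<inter> Range ?R = {}" "T \<inter> Domain ?R = {}" unfolding S T D R by blast+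
    show "S \<union> Range ?R = T \<union> Domain ?R"
      using ends unfolding S T D R by blast
  qed
qed

lemma linking_if_bij_betw:
  assumes bij: "bij_betw \<sigma> (V - T) (V - S)" and "S \<subseteq> V" "T \<subseteq> V"
    and arc: "\<And>v. v \<in> V - T \<Longrightarrow> \<sigma> v = v \<or> (v, \<sigma> v) \<in> A"
  shows "linking A S T {(v, \<sigma> v) | v. v \<in> V - T \<and> \<sigma> v \<noteq> v}" (is "linking _ _ _ ?R")
proof -
  have inj: "inj_on \<sigma> (V - T)" and im: "\<sigma> ` (V - T) = V - S"
    using bij unfolding bij_betw_def by blast+
  show ?thesis
    unfolding linking_def
  proof (intro conjI)
    show "?R \<subseteq> A" using arc by blast
    show "inj_on fst ?R" "inj_on snd ?R" using inj by (auto simp: inj_on_def)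
    show "S \<inter> Range ?R = {}" "T \<inter> Domain ?R = {}" using im by blast+
    show "S \<union> Range ?R = T \<union> Domain ?R"
    proof (intro equalityI subsetI)
      fix v assume v: "v \<in> S \<union> Range ?R"
      then have "v \<in> V" using im assms(2) by blast
      have "\<sigma> v \<noteq> v" if "v \<notin> T"
      proof
        assume fixed: "\<sigma> v = v"
        then have "v \<notin> S" using imageI[of v "V - T" \<sigma>] that \<open>v \<in> V\<close> unfolding im by simp
        then obtain u where "u \<in> V - T" "v = \<sigma> u" "u \<noteq> v" using v by auto
        then show False using inj_onD[OF inj, of u v] fixed that \<open>v \<in> V\<close> by simp
      qed
      then show "v \<in> T \<union> Domain ?R" using \<open>v \<in> V\<close> by blast
    next
      fix v assume v: "v \<in> T \<union> Domain ?R"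
      show "v \<in> S \<union> Range ?R"
      proof (cases "v \<in> S")
        case False
        then have "v \<in> \<sigma> ` (V - T)" using v im assms(3) by blast
        then obtain u where "u \<in> V - T" "v = \<sigma> u" by blast
        moreover have "\<sigma> u \<noteq> u" using v calculation by auto
        ultimately show ?thesis by blast
      qed simp
    qed
  qed
qed

lemma linking_if_card_le_card_Image:
  assumes V: "finite V" "S \<subseteq> V" "T \<subseteq> V" "card S = card T"
    and hall: "\<And>W. W \<subseteq> V - T \<Longrightarrow> card W \<le> card (A\<^sup>= `` W \<inter> (V - S))"
  shows "\<exists>R. linking A S T R"
proof -
  let ?F = "\<lambda>v. A\<^sup>= `` {v} \<inter> (V - S)"
  have "marriage_condition ?F (V - T)"
    unfolding marriage_condition_def
  proof (intro allI impI)
    fix W assume W: "W \<subseteq> V - T"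
    have "\<Union>(?F ` W) = A\<^sup>= `` W \<inter> (V - S)" by blast
    then show "card W \<le> card (\<Union>(?F ` W))" using hall[OF W] by (simp only:)
  qed
  then obtain \<sigma> where \<sigma>: "inj_on \<sigma> (V - T)" "\<forall>v\<in>V - T. \<sigma> v \<in> ?F v"
    using hall_marriage V(1) by blast
  have "\<sigma> ` (V - T) = V - S"
  proof (rule card_subset_eq)
    show "finite (V - S)" using V(1) by blast
    show "\<sigma> ` (V - T) \<subseteq> V - S" using \<sigma>(2) by blast
    show "card (\<sigma> ` (V - T)) = card (V - S)"
      using V \<sigma>(1) finite_subset[of _ V] by (simp add: card_image card_Diff_subset)
  qed
  then have "linking A S T {(v, \<sigma> v) | v. v \<in> V - T \<and> \<sigma> v \<noteq> v}"
    using \<sigma> V(2,3) by (intro linking_if_bij_betw[of _ V]) (auto simp: bij_betw_def)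
  then show ?thesis by blast
qed

lemma linking_image:
  assumes link: "linking A S T R" and inj: "inj_on f (S \<union> T \<union> Field A)"
  shows "linking (map_prod f f ` A) (f ` S) (f ` T) (map_prod f f ` R)"
proof -
  have D: "Domain (map_prod f f ` R) = f ` Domain R" and R: "Range (map_prod f f ` R) = f ` Range R"
    by force+
  have RA: "R \<subseteq> A" using link unfolding linking_def by blast
  then have sub: "Domain R \<subseteq> Field A" "Range R \<subseteq> Field A" unfolding Field_def by blast+
  show ?thesis
    unfolding linking_def D R
  proof (intro conjI)
    have "inj_on f (Domain R)" "inj_on f (Range R)"
      using sub by (auto intro: inj_on_subset[OF inj])
    then have "inj_on (f \<circ> fst) R" "inj_on (f \<circ> snd) R"
      using link unfolding linking_def by (simp_all add: comp_inj_on Domain_fst Range_snd)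
    then have "inj_on (fst \<circ> map_prod f f) R" "inj_on (snd \<circ> map_prod f f) R"
      by (simp_all add: comp_def)
    then show "inj_on fst (map_prod f f ` R)" "inj_on snd (map_prod f f ` R)"
      by (auto intro: inj_on_imageI)
    show "map_prod f f ` R \<subseteq> map_prod f f ` A" using RA by (rule image_mono)
    show "f ` S \<inter> f ` Range R = {}"
      using link sub inj_on_image_Int[OF inj, of S "Range R", symmetric]
      unfolding linking_def by auto
    show "f ` T \<inter> f ` Domain R = {}"
      using link sub inj_on_image_Int[OF inj, of T "Domain R", symmetric]
      unfolding linking_def by auto
    show "f ` S \<union> f ` Range R = f ` T \<union> f ` Domain R"
      using link unfolding linking_def by (metis image_Un)
  qed
qed

lemma linking_replace_arcs:
  assumes outer: "linking A S T (M \<union> K)" and inner: "linking B (Domain M) (Range M) Q"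
    and "M \<inter> K = {}" "Domain M \<inter> Range M = {}" "K \<subseteq> A'"
    and disj: "Domain K \<inter> Domain Q = {}" "Range K \<inter> Range Q = {}"
    and ends: "S \<inter> Range Q = {}" "T \<inter> Domain Q = {}"
  shows "linking (A' \<union> B) S T (K \<union> Q)"
proof -
  have K: "inj_on fst K" "inj_on snd K" "S \<inter> Range K = {}" "T \<inter> Domain K = {}"
    and flow: "S \<union> Range (M \<union> K) = T \<union> Domain (M \<union> K)"
    using outer unfolding linking_def inj_on_Un by auto
  have Q: "Q \<subseteq> B" "inj_on fst Q" "inj_on snd Q"
    and flow_Q: "Domain M \<union> Range Q = Range M \<union> Domain Q"
    using inner unfolding linking_def by auto
  show ?thesis
    unfolding linking_def
  proof (intro conjI)
    show "K \<union> Q \<subseteq> A' \<union> B" using assms(5) Q(1) by blast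
    show "inj_on fst (K \<union> Q)" "inj_on snd (K \<union> Q)"
      using K Q disj by (auto simp: inj_on_Un Domain_fst Range_snd)
    show "S \<inter> Range (K \<union> Q) = {}" "T \<inter> Domain (K \<union> Q) = {}"
      using K ends by auto
    show "S \<union> Range (K \<union> Q) = T \<union> Domain (K \<union> Q)"
    proof (rule set_eqI)
      fix v show "v \<in> S \<union> Range (K \<union> Q) \<longleftrightarrow> v \<in> T \<union> Domain (K \<union> Q)"
        using eqset_imp_iff[OF flow, of v] eqset_imp_iff[OF flow_Q, of v] assms(4)
        unfolding Domain_Un_eq Range_Un_eq by blast
    qed
  qed
qed

lemma linking_splice:
  assumes outer: "linking (A \<union> I \<times> J) S T R"
    and inner: "\<And>S' T'. S' \<subseteq> I \<Longrightarrow> T' \<subseteq> J \<Longrightarrow> card S' = card T' \<Longrightarrow> \<exists>Q. linking B S' T' Q"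
    and IJ: "I \<inter> J = {}" and AB: "Field A \<inter> Field B \<subseteq> I \<union> J"
    and terminal: "I \<inter> Range B = {}" "J \<inter> Domain B = {}"
    and ends: "S \<inter> Field B = {}" "T \<inter> Field B = {}"
  shows "\<exists>Q. linking (A \<union> B) S T Q"
proof -
  define M K where "M = R \<inter> I \<times> J" and "K = R - I \<times> J"
  have R: "R = M \<union> K" "M \<inter> K = {}" unfolding M_def K_def by blast+
  have outer': "linking (A \<union> I \<times> J) S T (M \<union> K)" using outer unfolding R(1) .
  have M: "Domain M \<subseteq> I" "Range M \<subseteq> J" and "K \<subseteq> A"
    using outer unfolding linking_def M_def K_def by blast+
  have inj: "inj_on fst M" "inj_on snd M" "Domain M \<inter> Domain K = {}" "Range M \<inter> Range K = {}"
    using outer' R(2) unfolding linking_def inj_on_Un Domain_fst Range_snd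
    by (simp_all add: Diff_triv Int_commute)
  obtain Q where Q: "linking B (Domain M) (Range M) Q"
    using inner[OF M card_Domain_eq_card_Range[OF inj(1,2)]] by blast
  then have flow: "Domain M \<union> Range Q = Range M \<union> Domain Q" and "Q \<subseteq> B"
    unfolding linking_def by auto
  then have QB: "Domain Q \<subseteq> Field B - J" "Range Q \<subseteq> Field B - I"
    using terminal unfolding Field_def by blast+
  have KA: "Domain K \<subseteq> Field A" "Range K \<subseteq> Field A"
    using \<open>K \<subseteq> A\<close> unfolding Field_def by blast+
  have "Domain Q \<subseteq> Domain M \<union> Range Q" "Range Q \<subseteq> Range M \<union> Domain Q" using flow by auto
  then have "Domain K \<inter> Domain Q = {}" "Range K \<inter> Range Q = {}"
    using KA QB AB inj(3,4) by blast+
  moreover have "Domain M \<inter> Range M = {}" "S \<inter> Range Q = {}" "T \<inter> Domain Q = {}"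
    using M IJ QB ends by blast+
  ultimately show ?thesis
    using linking_replace_arcs[OF outer' Q R(2) _ \<open>K \<subseteq> A\<close>] by blast
qed

subsection \<open>Superconcentrators\<close>

lemma disjoint_paths_iff_linking:
  assumes G: "pair_fin_digraph G" and "S \<subseteq> pverts G" "T \<subseteq> pverts G" "card S = card T"
  shows "(\<exists>P. finite P \<and> card P = card S \<and> disjoint_family_on set P \<and>
      (\<forall>p\<in>P. vpath p (with_proj G) \<and> hd p \<in> S \<and> last p \<in> T)) \<longleftrightarrow> (\<exists>R. linking (parcs G) S T R)"
    (is "?paths \<longleftrightarrow> _")
proof
  interpret pair_fin_digraph G by fact
  have fin: "finite S" "finite T" using assms(2,3) pair_finite_verts finite_subset by blast+
  show "\<exists>R. linking (parcs G) S T R" if ?paths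
    using that linking_if_paths[of _ S T G] fin assms(4) by metis
  assume "\<exists>R. linking (parcs G) S T R"
  then obtain R where R: "linking (parcs G) S T R" by blast
  then have "finite R"
    using finite_subset[OF _ pair_finite_arcs] unfolding linking_def by (elim conjE)
  then obtain \<pi> where \<pi>: "path_system G (S \<union> Range R) S T \<pi>"
    using path_system_if_linking[OF pair_wf_digraph_axioms _ R assms(2)] by meson
  have "inj_on \<pi> S" using \<pi> unfolding path_system_def by (metis inj_onI)
  moreover have "disjoint_family_on set (\<pi> ` S)"
    using \<pi> unfolding path_system_def disjoint_family_on_def by fast
  ultimately show ?paths
    using \<pi> fin unfolding path_system_def by (intro exI[of _ "\<pi> ` S"]) (auto simp: card_image)
qed

lemma superconcentrator_iff_linking:
  "superconcentrator N G I J \<longleftrightarrow>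
     pair_fin_digraph G \<and> acyclic (parcs G) \<and>
     I \<subseteq> pverts G \<and> J \<subseteq> pverts G \<and> I \<inter> J = {} \<and> card I = N \<and> card J = N \<and>
     (\<forall>S T. S \<subseteq> I \<and> T \<subseteq> J \<and> card S = card T \<longrightarrow> (\<exists>R. linking (parcs G) S T R))"
  unfolding superconcentrator_def using disjoint_paths_iff_linking[of G]
  by (smt (verit) subset_trans)

subsection \<open>The outer layer of the construction\<close>

datatype node = X nat | X' nat | Y' nat | Y nat

definition outer_arcs :: "nat \<Rightarrow> (nat \<times> nat) set \<Rightarrow> (node \<times> node) set" where
  "outer_arcs m E = {(X i, X' j) | i j. (i, j) \<in> E} \<union> {(Y' j, Y i) | i j. (i, j) \<in> E} \<union>
     (\<Union>i\<in>{1..m}. {(X' (i + m), Y' i), (X' (i + m), X' i), (X' i, Y' (i + m)), (Y' i, Y' (i + m))})"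

lemma in_outer_arcs_iff:
  "(u, X i) \<notin> outer_arcs m E"
  "(u, X' j) \<in> outer_arcs m E \<longleftrightarrow> (\<exists>i. u = X i \<and> (i, j) \<in> E) \<or> j \<in> {1..m} \<and> u = X' (j + m)"
  "(u, Y' j) \<in> outer_arcs m E \<longleftrightarrow>
     j \<in> {1..m} \<and> u = X' (j + m) \<or> (\<exists>i\<in>{1..m}. j = i + m \<and> (u = X' i \<or> u = Y' i))"
  "(u, Y i) \<in> outer_arcs m E \<longleftrightarrow> (\<exists>j. u = Y' j \<and> (i, j) \<in> E)"
  unfolding outer_arcs_def by auto

definition outer_verts :: "nat \<Rightarrow> nat set \<Rightarrow> nat set \<Rightarrow> node set" where
  "outer_verts m S T = X ` S \<union> X' ` {1..2 * m} \<union> Y' ` {1..2 * m} \<union> Y ` T"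

lemma in_outer_verts_iff:
  "X i \<in> outer_verts m S T \<longleftrightarrow> i \<in> S" "X' i \<in> outer_verts m S T \<longleftrightarrow> i \<in> {1..2 * m}"
  "Y' i \<in> outer_verts m S T \<longleftrightarrow> i \<in> {1..2 * m}" "Y i \<in> outer_verts m S T \<longleftrightarrow> i \<in> T"
  unfolding outer_verts_def by auto

definition pair_count :: "nat \<Rightarrow> nat set \<Rightarrow> nat \<Rightarrow> nat" where
  "pair_count m Z i = of_bool (i \<in> Z) + of_bool (i + m \<in> Z)"

lemma pair_count_le_2: "pair_count m Z i \<le> 2"
  unfolding pair_count_def by simp

lemma pair_count_mono: "Z \<subseteq> Z' \<Longrightarrow> pair_count m Z i \<le> pair_count m Z' i"
  unfolding pair_count_def by (auto intro!: add_mono)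

lemma sum_pair_count:
  assumes "Z \<subseteq> {1..2 * m}"
  shows "(\<Sum>i=1..m. pair_count m Z i) = card Z"
proof -
  let ?f = "\<lambda>i. of_bool (i \<in> Z) :: nat"
  have "{1..2 * m} = {1..m} \<union> {1 + m..m + m}" by auto
  then have "sum ?f {1..m} + sum ?f {1 + m..m + m} = sum ?f {1..2 * m}"
    by (subst sum.union_disjoint[symmetric]) auto
  also have "\<dots> = card Z" using assms by (simp add: of_bool_def sum.If_cases Int_absorb1)
  finally show ?thesis
    unfolding pair_count_def sum.distrib sum.shift_bounds_cl_nat_ivl .
qed

lemma sum_pair_count_add:
  assumes "A \<subseteq> {1..2 * m}" "B \<subseteq> {1..2 * m}"
  shows "(\<Sum>i=1..m. pair_count m A i + pair_count m B i) = card A + card B"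
  using assms by (simp only: sum.distrib sum_pair_count)

definition pair_capacity :: "nat \<Rightarrow> nat set \<Rightarrow> nat set \<Rightarrow> nat" where
  "pair_capacity m P Q = (\<Sum>i=1..m. min (pair_count m P i) (pair_count m Q i + 1))"

lemma pair_count_add_min_le:
  assumes "A \<union> P \<subseteq> A'" "B \<subseteq> B'" "B \<inter> Q = {}"
    and "i + m \<in> A \<Longrightarrow> i \<in> A' \<inter> B'" "i \<in> A \<union> B \<Longrightarrow> i + m \<in> B'"
  shows "i \<notin> A \<Longrightarrow> pair_count m A i + pair_count m B i + min (pair_count m P i) (pair_count m Q i + 1)
      \<le> pair_count m A' i + pair_count m B' i"
    and "i \<in> B' \<Longrightarrow> pair_count m A i + pair_count m B i + min (pair_count m Q i) (pair_count m P i + 1)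
      \<le> pair_count m A' i + pair_count m B' i"
proof -
  have sub: "j \<in> A \<Longrightarrow> j \<in> A'" "j \<in> P \<Longrightarrow> j \<in> A'" "j \<in> B \<Longrightarrow> j \<in> B'" "j \<in> B \<Longrightarrow> j \<notin> Q" for j
    using assms(1-3) by blast+
  show "i \<notin> A \<Longrightarrow> pair_count m A i + pair_count m B i + min (pair_count m P i) (pair_count m Q i + 1)
      \<le> pair_count m A' i + pair_count m B' i"
    using sub[of i] sub[of "i + m"] assms(4,5) unfolding pair_count_def
    by (cases "i + m \<in> A"; cases "i \<in> B"; cases "i + m \<in> B"; simp add: of_bool_def min_def)
  show "i \<in> B' \<Longrightarrow> pair_count m A i + pair_count m B i + min (pair_count m Q i) (pair_count m P i + 1)
      \<le> pair_count m A' i + pair_count m B' i"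
    using sub[of i] sub[of "i + m"] assms(4,5) unfolding pair_count_def
    by (cases "i \<in> A"; cases "i + m \<in> A"; cases "i \<in> B"; cases "i + m \<in> B";
        simp add: of_bool_def min_def)
qed

lemma card_add_pair_capacity_le:
  assumes sub: "A \<subseteq> {1..2 * m}" "B \<subseteq> {1..2 * m}" "A' \<subseteq> {1..2 * m}" "B' \<subseteq> {1..2 * m}"
    and incl: "A \<union> P \<subseteq> A'" "B \<subseteq> B'" "B \<inter> Q = {}"
    and upper: "\<And>i. i \<in> {1..m} \<Longrightarrow> i + m \<in> A \<Longrightarrow> i \<in> A' \<inter> B'"
    and lower: "\<And>i. i \<in> {1..m} \<Longrightarrow> i \<in> A \<union> B \<Longrightarrow> i + m \<in> B'"
    and inner: "A \<inter> {1..m} \<noteq> {} \<Longrightarrow> {1..m} \<subseteq> B'"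
  shows "card A + card B + min (pair_capacity m P Q) (pair_capacity m Q P) \<le> card A' + card B'"
proof (cases "A \<inter> {1..m} = {}")
  case True
  have "card A + card B + pair_capacity m P Q \<le> card A' + card B'"
    unfolding sum_pair_count_add[OF sub(1,2), symmetric] sum_pair_count_add[OF sub(3,4), symmetric]
      pair_capacity_def sum.distrib[symmetric]
    using True by (intro sum_mono pair_count_add_min_le(1)[OF incl upper lower]) auto
  then show ?thesis by linarith
next
  case False
  have "card A + card B + pair_capacity m Q P \<le> card A' + card B'"
    unfolding sum_pair_count_add[OF sub(1,2), symmetric] sum_pair_count_add[OF sub(3,4), symmetric]
      pair_capacity_def sum.distrib[symmetric]
    using inner[OF False] by (intro sum_mono pair_count_add_min_le(2)[OF incl upper lower]) auto
  then show ?thesis by linarith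
qed

lemma card_node_set:
  assumes "finite W"
  shows "card W = card (X -` W) + card (X' -` W) + card (Y' -` W) + card (Y -` W)"
proof -
  have inj: "inj X" "inj X'" "inj Y'" "inj Y" by (simp_all add: inj_def)
  have "W = X ` X -` W \<union> X' ` X' -` W \<union> Y' ` Y' -` W \<union> Y ` Y -` W" (is "_ = ?W")
  proof
    show "W \<subseteq> ?W"
    proof
      fix w assume "w \<in> W" then show "w \<in> ?W" by (cases w) auto
    qed
  qed auto
  also have "card \<dots> = card (X -` W) + card (X' -` W) + card (Y' -` W) + card (Y -` W)"
    using inj assms
    by (subst card_Un_disjoint;
        auto simp: finite_vimageI card_image inj_on_subset simp del: image_vimage_eq)+
  finally show ?thesis .
qed

abbreviation inner_arcs :: "nat \<Rightarrow> (node \<times> node) set" where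
  "inner_arcs m \<equiv> X' ` {1..m} \<times> Y' ` {1..m}"

definition outer_succs ::
    "nat \<Rightarrow> (nat \<times> nat) set \<Rightarrow> nat set \<Rightarrow> nat set \<Rightarrow> node set \<Rightarrow> node set" where
  "outer_succs m E S T W =
     (outer_arcs m E \<union> inner_arcs m)\<^sup>= `` W \<inter> (outer_verts m S T - X ` S)"

lemma in_outer_succs_iff:
  "X i \<notin> outer_succs m E S T W"
  "X' j \<in> outer_succs m E S T W \<longleftrightarrow> j \<in> {1..2 * m} \<and>
     (X' j \<in> W \<or> (\<exists>i. (i, j) \<in> E \<and> X i \<in> W) \<or> j \<le> m \<and> X' (j + m) \<in> W)"
  "Y' j \<in> outer_succs m E S T W \<longleftrightarrow> j \<in> {1..2 * m} \<and>
     (Y' j \<in> W \<or> j \<le> m \<and> (X' (j + m) \<in> W \<or> (\<exists>i\<in>{1..m}. X' i \<in> W)) \<or>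
      (\<exists>i\<in>{1..m}. j = i + m \<and> (X' i \<in> W \<or> Y' i \<in> W)))"
  "Y i \<in> outer_succs m E S T W \<longleftrightarrow> i \<in> T \<and> (Y i \<in> W \<or> (\<exists>j. (i, j) \<in> E \<and> Y' j \<in> W))"
proof -
  have succs: "w \<in> outer_succs m E S T W \<longleftrightarrow> w \<in> outer_verts m S T \<and> w \<notin> X ` S \<and>
      (w \<in> W \<or> (\<exists>u\<in>W. (u, w) \<in> outer_arcs m E \<or> (u, w) \<in> inner_arcs m))" for w
    unfolding outer_succs_def by blast
  show "X i \<notin> outer_succs m E S T W"
    unfolding succs in_outer_verts_iff by blast
  show "X' j \<in> outer_succs m E S T W \<longleftrightarrow> j \<in> {1..2 * m} \<and>
     (X' j \<in> W \<or> (\<exists>i. (i, j) \<in> E \<and> X i \<in> W) \<or> j \<le> m \<and> X' (j + m) \<in> W)"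
    unfolding succs in_outer_verts_iff in_outer_arcs_iff by auto
  show "Y' j \<in> outer_succs m E S T W \<longleftrightarrow> j \<in> {1..2 * m} \<and>
     (Y' j \<in> W \<or> j \<le> m \<and> (X' (j + m) \<in> W \<or> (\<exists>i\<in>{1..m}. X' i \<in> W)) \<or>
      (\<exists>i\<in>{1..m}. j = i + m \<and> (X' i \<in> W \<or> Y' i \<in> W)))"
    unfolding succs in_outer_verts_iff in_outer_arcs_iff by (rule conj_cong[OF refl]) auto
  show "Y i \<in> outer_succs m E S T W \<longleftrightarrow> i \<in> T \<and> (Y i \<in> W \<or> (\<exists>j. (i, j) \<in> E \<and> Y' j \<in> W))"
    unfolding succs in_outer_verts_iff in_outer_arcs_iff by auto
qed

definition pair_cut_condition :: "nat \<Rightarrow> (nat \<times> nat) set \<Rightarrow> nat set \<Rightarrow> nat set \<Rightarrow> bool" where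
  "pair_cut_condition m E S T \<longleftrightarrow> (\<forall>U\<subseteq>S. \<forall>V\<subseteq>T. card U + card V \<le>
     card T + min (pair_capacity m (E `` U) (E `` V)) (pair_capacity m (E `` V) (E `` U)))"

lemma card_le_card_outer_succs:
  assumes E: "E \<subseteq> {1..2 * m} \<times> {1..2 * m}" and ST: "S \<subseteq> {1..2 * m}" "T \<subseteq> {1..2 * m}"
    and cut: "pair_cut_condition m E S T" and W: "W \<subseteq> outer_verts m S T - Y ` T"
  shows "card W \<le> card (outer_succs m E S T W)"
proof -
  have fin: "finite (outer_verts m S T)" "finite T"
    using finite_subset[OF ST(1)] finite_subset[OF ST(2)] unfolding outer_verts_def by simp_all
  let ?N = "outer_succs m E S T W"
  define U A B where "U = X -` W" and "A = X' -` W" and "B = Y' -` W"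
  define A' B' T' where "A' = X' -` ?N" and "B' = Y' -` ?N" and "T' = Y -` ?N"
  note defs = U_def A_def B_def A'_def B'_def T'_def
  have sub: "U \<subseteq> S" "A \<subseteq> {1..2 * m}" "B \<subseteq> {1..2 * m}"
    using W unfolding defs outer_verts_def by auto
  have sub': "A' \<subseteq> {1..2 * m}" "B' \<subseteq> {1..2 * m}" "T' \<subseteq> T"
    unfolding defs by (auto simp: in_outer_succs_iff)
  have snd_in: "1 \<le> j" "j \<le> 2 * m" if "(i, j) \<in> E" for i j using that E by auto
  have "finite W" "finite ?N"
    using W fin(1) finite_subset unfolding outer_succs_def by blast+
  moreover have "Y -` W = {}" "X -` ?N = {}"
    using W by (auto simp: outer_verts_def in_outer_succs_iff)
  ultimately have "card W = card U + card A + card B" "card ?N = card A' + card B' + card T'"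
    unfolding defs card_node_set[OF \<open>finite W\<close>] card_node_set[OF \<open>finite ?N\<close>] by simp_all
  moreover have "card A + card B + min (pair_capacity m (E `` U) (E `` (T - T')))
      (pair_capacity m (E `` (T - T')) (E `` U)) \<le> card A' + card B'"
  proof (rule card_add_pair_capacity_le[OF sub(2,3) sub'(1,2)])
    show "A \<union> E `` U \<subseteq> A'" "B \<subseteq> B'"
      using sub(2,3) snd_in unfolding defs by (auto simp: in_outer_succs_iff)
    show "B \<inter> E `` (T - T') = {}"
      unfolding defs by (auto simp: in_outer_succs_iff)
    show "i \<in> A' \<inter> B'" if "i \<in> {1..m}" "i + m \<in> A" for i
      using that unfolding defs by (auto simp: in_outer_succs_iff)
    show "i + m \<in> B'" if "i \<in> {1..m}" "i \<in> A \<union> B" for i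
      using that unfolding defs by (auto simp: in_outer_succs_iff)
    show "{1..m} \<subseteq> B'" if "A \<inter> {1..m} \<noteq> {}"
      using that unfolding defs by (auto simp: in_outer_succs_iff)
  qed
  moreover have "card T = card (T - T') + card T'"
    using sub'(3) fin(2) by (simp add: card_Diff_subset card_mono finite_subset)
  moreover have "card U + card (T - T') \<le> card T + min (pair_capacity m (E `` U) (E `` (T - T')))
      (pair_capacity m (E `` (T - T')) (E `` U))"
    using cut sub(1) unfolding pair_cut_condition_def by simp
  ultimately show ?thesis by linarith
qed

lemma linking_outer_layer:
  assumes E: "E \<subseteq> {1..2 * m} \<times> {1..2 * m}"
    and ST: "S \<subseteq> {1..2 * m}" "T \<subseteq> {1..2 * m}" "card S = card T"
    and cut: "pair_cut_condition m E S T"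
  shows "\<exists>R. linking (outer_arcs m E \<union> inner_arcs m) (X ` S) (Y ` T) R"
proof (rule linking_if_card_le_card_Image)
  show "finite (outer_verts m S T)" "X ` S \<subseteq> outer_verts m S T" "Y ` T \<subseteq> outer_verts m S T"
    using finite_subset[OF ST(1)] finite_subset[OF ST(2)] unfolding outer_verts_def by auto
  show "card (X ` S) = card (Y ` T)" using ST(3) by (simp add: card_image inj_on_def)
qed (rule card_le_card_outer_succs[OF E ST(1,2) cut, unfolded outer_succs_def])

subsection \<open>The cut inequality from expansion\<close>

lemma card_half_pairs_le_pair_capacity:
  assumes "Z \<subseteq> P"
  shows "card {q \<in> half_pairs (2 * m). Z \<inter> q \<noteq> {}} \<le> pair_capacity m P Q"
proof -
  have "{q \<in> half_pairs (2 * m). Z \<inter> q \<noteq> {}} =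
      (\<lambda>i. {i, i + m}) ` {i \<in> {1..m}. pair_count m Z i \<noteq> 0}"
    unfolding half_pairs_def pair_count_def by auto
  then have "card {q \<in> half_pairs (2 * m). Z \<inter> q \<noteq> {}} \<le> card {i \<in> {1..m}. pair_count m Z i \<noteq> 0}"
    by (simp add: card_image_le)
  also have "\<dots> = (\<Sum>i=1..m. of_bool (pair_count m Z i \<noteq> 0))"
    by (simp add: of_bool_def sum.If_cases Int_def)
  also have "\<dots> \<le> pair_capacity m P Q"
    unfolding pair_capacity_def
  proof (rule sum_mono)
    fix i
    show "of_bool (pair_count m Z i \<noteq> 0) \<le> min (pair_count m P i) (pair_count m Q i + 1)"
      using pair_count_mono[OF assms, of m i] by simp
  qed
  finally show ?thesis .
qed

lemma pair_capacity_ge_card: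
  assumes "P \<subseteq> {1..2 * m}" "Q \<subseteq> {1..2 * m}"
  shows "2 * card P + card Q \<le> 2 * pair_capacity m P Q + 2 * m"
proof -
  have "2 * pair_count m P i + pair_count m Q i \<le>
      2 * min (pair_count m P i) (pair_count m Q i + 1) + 2" for i
    using pair_count_le_2[of m P i] pair_count_le_2[of m Q i] by (simp add: min_def)
  then have "(\<Sum>i=1..m. 2 * pair_count m P i + pair_count m Q i) \<le>
      (\<Sum>i=1..m. 2 * min (pair_count m P i) (pair_count m Q i + 1) + 2)" by (rule sum_mono)
  then show ?thesis
    unfolding pair_capacity_def sum.distrib sum_distrib_left[symmetric]
    by (simp only: sum_pair_count[OF assms(1)] sum_pair_count[OF assms(2)] sum_constant) simp
qed

definition threshold_expander :: "nat \<Rightarrow> real \<Rightarrow> (nat \<times> nat) set \<Rightarrow> bool" where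
  "threshold_expander m c E \<longleftrightarrow> E \<subseteq> {1..2 * m} \<times> {1..2 * m} \<and> (\<forall>U\<subseteq>{1..2 * m}.
     (real (card U) \<le> c \<longrightarrow> card U \<le> card {q \<in> half_pairs (2 * m). E `` U \<inter> q \<noteq> {}}) \<and>
     (c < real (card U) \<longrightarrow> 2 * m + 2 * card U \<le> 3 * card (E `` U)))"

lemma threshold_expanderD:
  assumes "threshold_expander m c E"
  shows "E \<subseteq> {1..2 * m} \<times> {1..2 * m}"
    and "U \<subseteq> {1..2 * m} \<Longrightarrow> real (card U) \<le> c \<Longrightarrow>
      card U \<le> card {q \<in> half_pairs (2 * m). E `` U \<inter> q \<noteq> {}}"
    and "U \<subseteq> {1..2 * m} \<Longrightarrow> c < real (card U) \<Longrightarrow> 2 * m + 2 * card U \<le> 3 * card (E `` U)"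
  using assms unfolding threshold_expander_def by simp_all

lemma card_add_card_le_pair_capacity:
  assumes exp: "threshold_expander m c E" and UV: "U \<subseteq> {1..2 * m}" "V \<subseteq> {1..2 * m}"
    and k: "card U \<le> k" "card V \<le> k"
  shows "card U + card V \<le> k + pair_capacity m (E `` U) (E `` V)"
proof -
  have small: "card W \<le> pair_capacity m (E `` U) (E `` V)" if "W \<subseteq> U" "card W \<le> c" for W
  proof -
    have "card W \<le> card {q \<in> half_pairs (2 * m). E `` W \<inter> q \<noteq> {}}"
      using threshold_expanderD(2)[OF exp subset_trans[OF that(1) UV(1)] that(2)] .
    also have "\<dots> \<le> pair_capacity m (E `` U) (E `` V)"
      using that(1) by (intro card_half_pairs_le_pair_capacity Image_mono) auto
    finally show ?thesis .
  qed
  consider "card U \<le> c" | "card V \<le> c" "card V \<le> card U" | "card U > c" "card V > c" by linarith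
  then show ?thesis
  proof cases
    case 1
    then show ?thesis using small[of U] k(2) by simp
  next
    case 2
    then obtain W where "W \<subseteq> U" "card W = card V" using obtain_subset_with_card_n by metis
    then show ?thesis using small[of W] 2(1) k(1) by simp
  next
    case 3
    have "2 * card (E `` U) + card (E `` V) \<le> 2 * pair_capacity m (E `` U) (E `` V) + 2 * m"
      using threshold_expanderD(1)[OF exp] by (intro pair_capacity_ge_card) auto
    then show ?thesis
      using threshold_expanderD(3)[OF exp UV(1) 3(1)] threshold_expanderD(3)[OF exp UV(2) 3(2)] k
      by linarith
  qed
qed

lemma pair_cut_condition_if_threshold_expander:
  assumes exp: "threshold_expander m c E"
    and ST: "S \<subseteq> {1..2 * m}" "T \<subseteq> {1..2 * m}" "card S = card T"
  shows "pair_cut_condition m E S T"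
  unfolding pair_cut_condition_def
proof (intro allI impI)
  fix U V assume UV: "U \<subseteq> S" "V \<subseteq> T"
  then have sub: "U \<subseteq> {1..2 * m}" "V \<subseteq> {1..2 * m}" using ST by blast+
  have "finite S" "finite T" using finite_subset[OF ST(1)] finite_subset[OF ST(2)] by simp_all
  then have le: "card U \<le> card T" "card V \<le> card T" using UV ST(3) card_mono by metis+
  show "card U + card V \<le>
      card T + min (pair_capacity m (E `` U) (E `` V)) (pair_capacity m (E `` V) (E `` U))"
    using card_add_card_le_pair_capacity[OF exp sub le]
      card_add_card_le_pair_capacity[OF exp sub(2,1) le(2,1)]
    by simp
qed

lemma pw_linear_ge:
  assumes "C1 < C3" "C3 < C5" "C5 < 1" "C3 < t" "t \<le> 1"
    and "(C6 - C4) / (C5 - C3) = 1" "3 * C4 \<ge> 1 + 2 * C3"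
  shows "3 * pw_linear C1 C2 C3 C4 C5 C6 t \<ge> 1 + 2 * t"
proof (cases "t \<le> C5")
  case True
  then show ?thesis using assms unfolding pw_linear_def by simp
next
  case False
  define r where "r = (1 - C6) / (1 - C5)"
  have r: "r * (1 - C5) = 1 - C6" using assms unfolding r_def by auto
  have C6: "C6 = C4 + C5 - C3" using assms by (simp add: field_simps)
  then have "r * (1 - C5) \<le> 2 / 3 * (1 - C5)" using r assms by simp
  then have "r \<le> 2 / 3" using assms(3) mult_right_le_imp_le[of r "1 - C5" "2 / 3"] by simp
  then have "r * (1 - t) \<le> 2 / 3 * (1 - t)" using assms(5) by (intro mult_right_mono) auto
  moreover have "pw_linear C1 C2 C3 C4 C5 C6 t = C6 + r * (t - C5)"
    using False assms unfolding pw_linear_def r_def by simp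
  then have "pw_linear C1 C2 C3 C4 C5 C6 t = 1 - r * (1 - t)"
    using r by (simp add: algebra_simps)
  ultimately show ?thesis by simp
qed

lemma card_Image_if_expander:
  fixes \<beta> :: real
  assumes "expander N (card U / N) \<beta> E" "U \<subseteq> {1..N}" "U \<noteq> {}"
  shows "\<beta> * N \<le> card (E `` U)"
proof -
  have "N \<noteq> 0" using assms(2,3) by auto
  then have "\<lceil>\<beta> * real N\<rceil> \<le> int (card (E `` U))" using assms unfolding expander_def by simp
  then show ?thesis by (simp add: ceiling_le_iff)
qed

lemma card_le_pairs_if_pair_expander:
  assumes "pair_expander N (card U / N) 1 Q E" "U \<subseteq> {1..N}"
  shows "card U \<le> card {q \<in> Q. E `` U \<inter> q \<noteq> {}}"
  using assms by (cases "N = 0") (auto simp: pair_expander_def)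

lemma threshold_expander_if_expander:
  assumes "E \<subseteq> {1..2 * m} \<times> {1..2 * m}" "0 \<le> a"
    and e: "\<And>t. a < t \<Longrightarrow> t \<le> 1 \<Longrightarrow> 1 + 2 * t \<le> 3 * e t"
    and exp: "\<And>t. t \<in> {0..1} \<Longrightarrow> expander (2 * m) t (e t) E"
    and pair: "\<And>t. t \<in> {0..a} \<Longrightarrow> pair_expander (2 * m) t 1 (half_pairs (2 * m)) E"
  shows "threshold_expander m (a * (2 * m)) E"
proof -
  let ?t = "\<lambda>U :: nat set. card U / (2 * m)"
  have t: "0 \<le> ?t U" "?t U \<le> 1" if "U \<subseteq> {1..2 * m}" for U
    using card_mono[OF _ that] by (simp_all add: divide_le_eq)
  have "card U \<le> card {q \<in> half_pairs (2 * m). E `` U \<inter> q \<noteq> {}}"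
    if U: "U \<subseteq> {1..2 * m}" "card U \<le> a * (2 * m)" for U
  proof -
    have "?t U \<le> a" using U(2) assms(2) by (simp add: divide_le_eq)
    then show ?thesis using card_le_pairs_if_pair_expander[OF _ U(1)] pair t(1)[OF U(1)] by simp
  qed
  moreover have "2 * m + 2 * card U \<le> 3 * card (E `` U)"
    if U: "U \<subseteq> {1..2 * m}" "a * (2 * m) < card U" for U
  proof -
    have "0 \<le> a * (2 * m)" using assms(2) by simp
    then have "U \<noteq> {}" using U(2) by auto
    then have "m \<noteq> 0" using U(1) by (cases m) auto
    then have "a < ?t U" using U(2) by (simp add: less_divide_eq)
    then have "(1 + 2 * ?t U) * (2 * m) \<le> 3 * e (?t U) * (2 * m)"
      using e[OF _ t(2)[OF U(1)]] by (intro mult_right_mono) simp_all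
    moreover have "(1 + 2 * ?t U) * (2 * m) = 2 * m + 2 * card U"
      using \<open>m \<noteq> 0\<close> by (simp add: field_simps)
    moreover have "e (?t U) * (2 * m) \<le> card (E `` U)"
      using card_Image_if_expander[OF _ U(1) \<open>U \<noteq> {}\<close>] exp t[OF U(1)] by simp
    ultimately have "real (2 * m + 2 * card U) \<le> real (3 * card (E `` U))" by linarith
    then show ?thesis by (simp only: of_nat_le_iff)
  qed
  ultimately show ?thesis unfolding threshold_expander_def using assms(1) by simp
qed

subsection \<open>The recursive construction\<close>

abbreviation all_verts :: "nat \<Rightarrow> node set" where
  "all_verts m \<equiv> outer_verts m {1..2 * m} {1..2 * m}"

definition sources_and_sinks :: "'v pair_pre_digraph \<Rightarrow> 'v set \<Rightarrow> 'v set \<Rightarrow> bool" where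
  "sources_and_sinks G I J \<longleftrightarrow> I \<inter> Range (parcs G) = {} \<and> J \<inter> Domain (parcs G) = {}"

lemma outer_arcs_subset:
  assumes "E \<subseteq> {1..2 * m} \<times> {1..2 * m}"
  shows "outer_arcs m E \<subseteq> (all_verts m - range Y) \<times> (all_verts m - range X)"
  using assms unfolding outer_arcs_def outer_verts_def by auto

fun node_level :: "nat \<Rightarrow> node \<Rightarrow> nat" where
  "node_level m (X i) = 0"
| "node_level m (X' i) = (if i \<in> {1..m} then 2 else 1)"
| "node_level m (Y' i) = (if i \<in> {1..m} then 2 else 3)"
| "node_level m (Y i) = 4"

lemma node_level_less: "(a, b) \<in> outer_arcs m E \<Longrightarrow> node_level m a < node_level m b"
  unfolding outer_arcs_def by auto

lemma acyclic_if_level: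
  fixes level :: "'v \<Rightarrow> nat"
  assumes "acyclic R" "finite R"
    and up: "\<And>u v. (u, v) \<in> R' \<Longrightarrow> level u < level v \<or> level u = level v \<and> (u, v) \<in> R"
  shows "acyclic R'"
proof (rule wf_acyclic, rule wf_subset)
  show "wf (inv_image (less_than <*lex*> R) (\<lambda>v. (level v, v)))"
    using assms(1,2) by (intro wf_inv_image wf_lex_prod wf_less_than finite_acyclic_wf)
  show "R' \<subseteq> inv_image (less_than <*lex*> R) (\<lambda>v. (level v, v))"
    using up by (auto simp: in_inv_image)
qed

locale outer_layer =
  fixes m :: nat and E :: "(nat \<times> nat) set" and H :: "'v pair_pre_digraph" and f :: "node \<Rightarrow> 'v"
  assumes edges: "E \<subseteq> {1..2 * m} \<times> {1..2 * m}"
    and inj: "inj_on f (all_verts m)"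
    and new_verts: "\<And>a. a \<in> all_verts m \<Longrightarrow> f a \<in> pverts H \<Longrightarrow> a \<in> X' ` {1..m} \<union> Y' ` {1..m}"
    and inner_super: "superconcentrator m H (f ` X' ` {1..m}) (f ` Y' ` {1..m})"
    and inner_ends: "sources_and_sinks H (f ` X' ` {1..m}) (f ` Y' ` {1..m})"
begin

definition extension :: "'v pair_pre_digraph" where
  "extension = \<lparr>pverts = pverts H \<union> f ` all_verts m,
     parcs = parcs H \<union> map_prod f f ` outer_arcs m E\<rparr>"

lemma inner_digraph: "pair_fin_digraph H" and inner_acyclic: "acyclic (parcs H)"
  using inner_super unfolding superconcentrator_def by auto

sublocale H: pair_fin_digraph H
  by (rule inner_digraph)

lemma Field_inner: "Field (parcs H) \<subseteq> pverts H"
  using H.arc_fst_in_verts H.arc_snd_in_verts by (force simp: Field_def)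

lemma in_inner_verts_iff:
  assumes "a \<in> all_verts m"
  shows "f a \<in> pverts H \<longleftrightarrow> a \<in> X' ` {1..m} \<union> Y' ` {1..m}"
proof
  show "a \<in> X' ` {1..m} \<union> Y' ` {1..m}" if "f a \<in> pverts H" using assms that by (rule new_verts)
  have "f ` X' ` {1..m} \<subseteq> pverts H" "f ` Y' ` {1..m} \<subseteq> pverts H"
    using inner_super unfolding superconcentrator_def by simp_all
  then show "f a \<in> pverts H" if "a \<in> X' ` {1..m} \<union> Y' ` {1..m}" using that by auto
qed

lemma image_Int_empty:
  assumes "A \<subseteq> all_verts m" "B \<subseteq> all_verts m" "A \<inter> B = {}"
  shows "f ` A \<inter> f ` B = {}"
  using inj_on_image_Int[OF inj assms(1,2)] assms(3) by simp

lemma pair_fin_digraph_extension: "pair_fin_digraph extension"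
proof
  have finV: "finite (all_verts m)" unfolding outer_verts_def by simp
  show "fst e \<in> pverts extension" "snd e \<in> pverts extension" if "e \<in> parcs extension" for e
    using that H.arc_fst_in_verts H.arc_snd_in_verts outer_arcs_subset[OF edges]
    unfolding extension_def by fastforce+
  show "finite (pverts extension)" using H.pair_finite_verts finV unfolding extension_def by simp
  have "finite (outer_arcs m E)"
    using outer_arcs_subset[OF edges] by (rule finite_subset) (use finV in simp)
  then show "finite (parcs extension)"
    using H.pair_finite_arcs unfolding extension_def by simp
qed

lemma acyclic_extension: "acyclic (parcs extension)"
proof (rule acyclic_if_level[OF inner_acyclic H.pair_finite_arcs])
  define level where
    "level v = (if v \<in> pverts H then 2 else node_level m (inv_into (all_verts m) f v))" for v
  have level: "level (f a) = node_level m a" if "a \<in> all_verts m" for a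
    using in_inner_verts_iff[OF that] inj that unfolding level_def by auto
  fix u v assume "(u, v) \<in> parcs extension"
  then consider "(u, v) \<in> parcs H" | a b where "(a, b) \<in> outer_arcs m E" "u = f a" "v = f b"
    unfolding extension_def by auto
  then show "level u < level v \<or> level u = level v \<and> (u, v) \<in> parcs H"
  proof cases
    case 1
    then show ?thesis using Field_inner unfolding level_def
      by (auto simp: FieldI1 FieldI2 subset_iff)
  next
    case 2
    then show ?thesis using node_level_less[OF 2(1)] outer_arcs_subset[OF edges] level by auto
  qed
qed

lemma sources_and_sinks_extension:
  "sources_and_sinks extension (f ` X ` {1..2 * m}) (f ` Y ` {1..2 * m})"
proof -
  let ?X = "X ` {1..2 * m}" and ?Y = "Y ` {1..2 * m}"
  have "f a \<notin> pverts H" if "a \<in> ?X \<union> ?Y" for a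
    using that in_inner_verts_iff by (auto simp: in_outer_verts_iff)
  then have "f ` ?X \<inter> Range (parcs H) = {}" "f ` ?Y \<inter> Domain (parcs H) = {}"
    using Field_inner unfolding Field_def by blast+
  moreover have "f ` ?X \<inter> f ` Range (outer_arcs m E) = {}"
    "f ` ?Y \<inter> f ` Domain (outer_arcs m E) = {}"
    using outer_arcs_subset[OF edges] by (intro image_Int_empty; force simp: in_outer_verts_iff)+
  moreover have "Range (map_prod f f ` A) = f ` Range A"
    "Domain (map_prod f f ` A) = f ` Domain A" for A
    by force+
  ultimately show ?thesis
    unfolding sources_and_sinks_def extension_def
    by (simp add: Domain_Un_eq Range_Un_eq Int_Un_distrib)
qed

lemma linking_extension:
  assumes exp: "threshold_expander m c E"
    and ST: "S \<subseteq> {1..2 * m}" "T \<subseteq> {1..2 * m}" "card S = card T"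
  shows "\<exists>R. linking (parcs extension) (f ` X ` S) (f ` Y ` T) R"
proof -
  obtain R where R: "linking (outer_arcs m E \<union> inner_arcs m) (X ` S) (Y ` T) R"
    using linking_outer_layer[OF edges ST pair_cut_condition_if_threshold_expander[OF exp ST]]
    by blast
  have sub: "X ` S \<union> Y ` T \<union> Field (outer_arcs m E \<union> inner_arcs m) \<subseteq> all_verts m"
    using outer_arcs_subset[OF edges] ST(1,2) unfolding Field_def by (auto simp: in_outer_verts_iff)
  let ?I = "f ` X' ` {1..m}" and ?J = "f ` Y' ` {1..m}" and ?A = "map_prod f f ` outer_arcs m E"
  have "map_prod f f ` (outer_arcs m E \<union> inner_arcs m) = ?A \<union> ?I \<times> ?J"
    unfolding image_Un by (simp only: map_prod_surj_on[OF refl refl])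
  then have "linking (?A \<union> ?I \<times> ?J) (f ` X ` S) (f ` Y ` T) (map_prod f f ` R)"
    using linking_image[OF R inj_on_subset[OF inj sub]] by simp
  then have "\<exists>Q. linking (?A \<union> parcs H) (f ` X ` S) (f ` Y ` T) Q"
  proof (rule linking_splice)
    show "\<exists>Q. linking (parcs H) S' T' Q" if "S' \<subseteq> ?I" "T' \<subseteq> ?J" "card S' = card T'" for S' T'
      using inner_super that unfolding superconcentrator_iff_linking by blast
    show "?I \<inter> ?J = {}" using inner_super unfolding superconcentrator_def by (elim conjE)
    have FA: "Field ?A \<subseteq> f ` all_verts m"
      using outer_arcs_subset[OF edges] unfolding Field_def by force
    show "Field ?A \<inter> Field (parcs H) \<subseteq> ?I \<union> ?J"
    proof
      fix v assume "v \<in> Field ?A \<inter> Field (parcs H)"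
      then obtain a where "a \<in> all_verts m" "v = f a" "f a \<in> pverts H" using FA Field_inner by auto
      then show "v \<in> ?I \<union> ?J" using new_verts[of a] by auto
    qed
    show "?I \<inter> Range (parcs H) = {}" "?J \<inter> Domain (parcs H) = {}"
      using inner_ends unfolding sources_and_sinks_def by blast+
    have "f a \<notin> pverts H" if "a \<in> X ` S \<union> Y ` T" for a
      using that ST(1,2) in_inner_verts_iff[of a] by (auto simp: in_outer_verts_iff)
    then show "f ` X ` S \<inter> Field (parcs H) = {}" "f ` Y ` T \<inter> Field (parcs H) = {}"
      using Field_inner by blast+
  qed
  then show ?thesis unfolding extension_def by (simp add: Un_commute)
qed

lemma superconcentrator_extension:
  assumes "threshold_expander m c E"
  shows "superconcentrator (2 * m) extension (f ` X ` {1..2 * m}) (f ` Y ` {1..2 * m})"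
proof -
  have inj': "inj_on (f \<circ> X) {1..2 * m}" "inj_on (f \<circ> Y) {1..2 * m}"
    using inj_on_eq_iff[OF inj] by (auto simp: inj_on_def in_outer_verts_iff)
  then have card: "card (f ` X ` S) = card S" "card (f ` Y ` S) = card S" if "S \<subseteq> {1..2 * m}" for S
    using that by (metis card_image image_comp inj_on_subset)+
  show ?thesis
    unfolding superconcentrator_iff_linking
  proof (intro conjI allI impI)
    show "f ` X ` {1..2 * m} \<subseteq> pverts extension" "f ` Y ` {1..2 * m} \<subseteq> pverts extension"
      unfolding extension_def by (auto simp: in_outer_verts_iff)
    show "f ` X ` {1..2 * m} \<inter> f ` Y ` {1..2 * m} = {}"
      by (intro image_Int_empty) (auto simp: in_outer_verts_iff)
    fix S T assume ST: "S \<subseteq> f ` X ` {1..2 * m} \<and> T \<subseteq> f ` Y ` {1..2 * m} \<and> card S = card T"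
    obtain S\<^sub>0 where S: "S\<^sub>0 \<subseteq> {1..2 * m}" "S = f ` X ` S\<^sub>0" using ST by (metis subset_image_iff)
    obtain T\<^sub>0 where T: "T\<^sub>0 \<subseteq> {1..2 * m}" "T = f ` Y ` T\<^sub>0" using ST by (metis subset_image_iff)
    show "\<exists>R. linking (parcs extension) S T R"
      using linking_extension[OF assms S(1) T(1)] ST card S T by simp
  qed (simp_all add: pair_fin_digraph_extension acyclic_extension card)
qed

end

lemma map_prod_outer_arcs:
  "map_prod f f ` outer_arcs m E = {(f (X i), f (X' j)) | i j. (i, j) \<in> E}
     \<union> {(f (Y' j), f (Y i)) | i j. (i, j) \<in> E}
     \<union> (\<Union>i\<in>{1..m}. {(f (X' (i + m)), f (Y' i)), (f (X' (i + m)), f (X' i)),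
          (f (X' i), f (Y' (i + m))), (f (Y' i), f (Y' (i + m)))})"
proof -
  have "map_prod f f ` {(X i, X' j) | i j. (i, j) \<in> E} = {(f (X i), f (X' j)) | i j. (i, j) \<in> E}"
    "map_prod f f ` {(Y' j, Y i) | i j. (i, j) \<in> E} = {(f (Y' j), f (Y i)) | i j. (i, j) \<in> E}"
    by force+
  then show ?thesis
    unfolding outer_arcs_def image_Un image_UN
    by (simp only: image_insert image_empty map_prod_simp)
qed

lemma image_all_verts:
  "f ` all_verts m = (\<lambda>i. f (X i)) ` {1..2 * m} \<union> (\<lambda>i. f (Y i)) ` {1..2 * m} \<union>
     (\<lambda>i. f (X' i)) ` {1..2 * m} \<union> (\<lambda>i. f (Y' i)) ` {1..2 * m}"
  unfolding outer_verts_def image_Un image_image by blast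

lemma inj_on_case_node:
  assumes "distinct (map x [1..<Suc (2 * m)] @ map y [1..<Suc (2 * m)] @
    map x' [1..<Suc (2 * m)] @ map y' [1..<Suc (2 * m)])"
  shows "inj_on (case_node x x' y' y) (all_verts m)"
proof -
  let ?L = "[1..<Suc (2 * m)]"
  let ?vs = "map X ?L @ map Y ?L @ map X' ?L @ map Y' ?L"
  have "map (case_node x x' y' y) ?vs = map x ?L @ map y ?L @ map x' ?L @ map y' ?L"
    unfolding map_append map_map comp_def node.case by (rule refl)
  with assms have "distinct (map (case_node x x' y' y) ?vs)" by (simp only:)
  then have "inj_on (case_node x x' y' y) (set ?vs)" unfolding distinct_map by (rule conjunct2)
  moreover have "set ?vs = all_verts m" unfolding outer_verts_def by auto
  ultimately show ?thesis by simp
qed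

lemma outer_layer_case_node:
  assumes "E \<subseteq> {1..2 * m} \<times> {1..2 * m}"
    and inner: "superconcentrator m H (x' ` {1..m}) (y' ` {1..m})"
      "sources_and_sinks H (x' ` {1..m}) (y' ` {1..m})"
    and "distinct (map x [1..<Suc (2 * m)] @ map y [1..<Suc (2 * m)] @
      map x' [1..<Suc (2 * m)] @ map y' [1..<Suc (2 * m)])"
    and new: "(x ` {1..2 * m} \<union> y ` {1..2 * m} \<union> x' ` {m<..2 * m} \<union> y' ` {m<..2 * m})
      \<inter> pverts H = {}"
  shows "outer_layer m E H (case_node x x' y' y)"
proof
  let ?f = "case_node x x' y' y"
  show "a \<in> X' ` {1..m} \<union> Y' ` {1..m}" if "a \<in> all_verts m" "?f a \<in> pverts H" for a
  proof (rule ccontr)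
    assume "a \<notin> X' ` {1..m} \<union> Y' ` {1..m}"
    then have "?f a \<in> x ` {1..2 * m} \<union> y ` {1..2 * m} \<union> x' ` {m<..2 * m} \<union> y' ` {m<..2 * m}"
      using that(1) by (cases a) (auto simp: in_outer_verts_iff image_iff not_le)
    then show False using that(2) new by blast
  qed
  show "superconcentrator m H (?f ` X' ` {1..m}) (?f ` Y' ` {1..m})"
    "sources_and_sinks H (?f ` X' ` {1..m}) (?f ` Y' ` {1..m})"
    unfolding image_image node.case by (fact inner)+
qed (fact assms(1) inj_on_case_node[OF assms(4)])+

lemma Gamma_superconcentrator:
  assumes exp: "\<And>m. \<exists>c. threshold_expander m c (E (2 * m))" and "Gamma E N\<^sub>0 N G x y"
  shows "superconcentrator N G (x ` {1..N}) (y ` {1..N}) \<and>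
    sources_and_sinks G (x ` {1..N}) (y ` {1..N})"
  using assms(2)
proof (induction rule: Gamma.induct)
  case (base N G x y)
  then show ?case unfolding sources_and_sinks_def by blast
next
  case (step N H x' y' x y)
  obtain m where N: "N = 2 * m" "N div 2 = m" using step.hyps(2) by auto
  obtain c where c: "threshold_expander m c (E (2 * m))" using exp by blast
  interpret outer_layer m "E (2 * m)" H "case_node x x' y' y"
  proof (rule outer_layer_case_node[OF threshold_expanderD(1)[OF c] _ _
        step.hyps(4)[unfolded N(1)] step.hyps(5)[unfolded N(2), unfolded N(1)]])
    show "superconcentrator m H (x' ` {1..m}) (y' ` {1..m})"
      "sources_and_sinks H (x' ` {1..m}) (y' ` {1..m})"
      using step.IH unfolding N(2) by blast+
  qed
  have "extension =
      \<lparr>pverts = pverts H \<union> x ` {1..N} \<union> y ` {1..N} \<union> x' ` {1..N} \<union> y' ` {1..N},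
       parcs = parcs H
         \<union> {(x i, x' j) | i j. (i, j) \<in> E N}
         \<union> {(y' j, y i) | i j. (i, j) \<in> E N}
         \<union> (\<Union>i\<in>{1..N div 2}.
              {(x' (i + N div 2), y' i), (x' (i + N div 2), x' i),
               (x' i, y' (i + N div 2)), (y' i, y' (i + N div 2))})\<rparr>"
    unfolding extension_def image_all_verts map_prod_outer_arcs node.case N(2) unfolding N(1)
    by (simp only: Un_assoc)
  then show ?case
    using superconcentrator_extension[OF c] sources_and_sinks_extension
    unfolding image_image node.case N(1)[symmetric] by simp
qed

theorem theorem2p2:
  fixes C1 C2 C3 C4 C5 C6 :: real
    and E :: "nat \<Rightarrow> (nat \<times> nat) set"
    and N\<^sub>0 N :: nat
    and G :: "'v pair_pre_digraph"
    and x y :: "nat \<Rightarrow> 'v"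
  assumes "{C1, C2, C3, C4, C5, C6} \<subseteq> {0<..<1}"
    and "C1 < C3" and "C3 < C5"
    and "C2 + C4 \<ge> 1"
    and "C1 + C2 + C3 \<le> 1"
    and "C2 / C1 > (C4 - C2) / (C3 - C1)"
    and "(C4 - C2) / (C3 - C1) > (C6 - C4) / (C5 - C3)"
    and "(C6 - C4) / (C5 - C3) = 1"
    and "1 > (1 - C6) / (1 - C5)"
    and "\<And>M. bipartite_edges M (E M)"
    and "\<And>M \<alpha>. \<alpha> \<in> {0..1} \<Longrightarrow> expander M \<alpha> (pw_linear C1 C2 C3 C4 C5 C6 \<alpha>) (E M)"
    and "\<And>M \<alpha>. even M \<Longrightarrow> \<alpha> \<in> {0..C3} \<Longrightarrow> pair_expander M \<alpha> 1 (half_pairs M) (E M)"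
    and "Gamma E N\<^sub>0 N G x y"
  shows "superconcentrator N G (x ` {1..N}) (y ` {1..N})"
proof -
  have C: "0 \<le> C3" "C5 < 1" using assms(1) by auto
  have "C3 - C1 < C4 - C2" using assms(2,7,8) by (simp add: less_divide_eq)
  then have C4: "3 * C4 \<ge> 1 + 2 * C3" using assms(4,5) by linarith
  have "threshold_expander m (C3 * (2 * m)) (E (2 * m))" for m
  proof (rule threshold_expander_if_expander)
    show "E (2 * m) \<subseteq> {1..2 * m} \<times> {1..2 * m}"
      using assms(10) unfolding bipartite_edges_def .
    show "1 + 2 * t \<le> 3 * pw_linear C1 C2 C3 C4 C5 C6 t" if "C3 < t" "t \<le> 1" for t
      using that assms(2,3,8) C(2) C4 by (intro pw_linear_ge)
  qed (use C(1) assms(11,12) in auto)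
  then show ?thesis using Gamma_superconcentrator assms(13) by blast
qed

end
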